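(* Let $q\in(0,1)$, $\phi(q)=-\log(1-q)$, and let $c,r\in\mathbb{N}$ be fixed. For $n\in\mathbb{N}$ let $Y_{n:n}^{(c)}$ be the maximum of $n$ i.i.d. $\mathrm{NegBin}(c,q)$ random variables. Then, as $n\to\infty$, $$\mathbb{E}\bigl[(Y_{n:n}^{(c)})^r\bigr]\sim\Bigl(\frac{1}{\phi(q)}\log n\Bigr)^r.$$
   Context: $f(n)\sim g(n)$ means $\lim_{n\to\infty}f(n)/g(n)=1$. $\mathrm{NegBin}(c,q)$ is the law of the sum of $c$ independent geometric random variables on $\{1,2,\ldots\}$ with success probability $q$. *)

theory Defs
  imports "HOL-Probability.Probability" "HOL-Library.Landau_Symbols"
begin

(* The library's geometric_pmf counts failures and so lives on {0, 1, ...};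
   this is the number of trials, supported on {1, 2, ...}. *)
definition geometric1_pmf :: "real \<Rightarrow> nat pmf" where
  "geometric1_pmf q = map_pmf Suc (geometric_pmf q)"

(* Pi_pmf is the law of independent coordinates indexed by {..<c}; its second
   argument is only the irrelevant value of the coordinates outside {..<c}. *)
definition NegBin :: "nat \<Rightarrow> real \<Rightarrow> nat pmf" where
  "NegBin c q =
     map_pmf (\<lambda>x. \<Sum>i<c. x i) (Pi_pmf {..<c} 0 (\<lambda>_. geometric1_pmf q))"

definition phi :: "real \<Rightarrow> real" where
  "phi q = - ln (1 - q)"

definition iid_sample :: "'a measure \<Rightarrow> nat \<Rightarrow> (nat \<Rightarrow> 'a \<Rightarrow> nat) \<Rightarrow> nat pmf \<Rightarrow> bool" where
  "iid_sample M n X p \<longleftrightarrow>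
     prob_space M \<and>
     prob_space.indep_vars M (\<lambda>_. count_space UNIV) X {..<n} \<and>
     (\<forall>i<n. distr M (count_space UNIV) (X i) = measure_pmf p)"

(* Meaningful for n > 0 only: Max {} is unspecified. *)
definition sample_max :: "nat \<Rightarrow> (nat \<Rightarrow> 'a \<Rightarrow> nat) \<Rightarrow> 'a \<Rightarrow> nat" where
  "sample_max n X \<omega> = Max ((\<lambda>i. X i \<omega>) ` {..<n})"

end

theory Submission
  imports Defs "HOL-Real_Asymp.Real_Asymp"
begin

text \<open>
  Put \<open>L = ln n / phi q\<close>. A negative binomial variable dominates a single geometric one, so for
  \<open>\<alpha> < 1\<close> the maximum exceeds \<open>\<alpha> L\<close> with probability at least \<open>1 - exp (- n powr (1 - \<alpha>))\<close>, and
  Markov's inequality bounds the moment from below by \<open>(\<alpha> L) ^ r\<close> times this probability.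
  For the upper bound, let \<open>0 < \<beta> < \<theta> < phi q\<close>. Splitting at \<open>T = ln n / \<beta>\<close> gives
  \<open>y ^ r \<le> T ^ r + C exp (- \<beta> T) exp (\<theta> y)\<close>. Here \<open>exp (- \<beta> T) = 1 / n\<close>, which cancels the union
  bound \<open>E (exp (\<theta> max)) \<le> n E (exp (\<theta> Y))\<close>, so the moment is at most \<open>(ln n / \<beta>) ^ r + O(1)\<close>.
\<close>

section \<open>Constants and domination of powers by exponentials\<close>

lemma phi_pos: "0 < q \<Longrightarrow> q < 1 \<Longrightarrow> 0 < phi q"
  by (simp add: phi_def)

lemma exp_minus_phi: "q < 1 \<Longrightarrow> exp (- phi q) = 1 - q"
  by (simp add: phi_def)

text \<open>Lets an exponential moment control the \<open>r\<close>-th moment: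
  \<open>x \<le> exp x\<close> is applied at \<open>x = \<eta> * y / r\<close>, so that raising to
  the power \<open>r\<close> restores the exponent \<open>\<eta> * y\<close>.\<close>

lemma power_le_exp:
  fixes y \<eta> :: real
  assumes "0 \<le> y" "0 < \<eta>" "r \<ge> 1"
  shows "y ^ r \<le> (real r / \<eta>) ^ r * exp (\<eta> * y)"
proof -
  have "\<eta> * y / real r \<le> exp (\<eta> * y / real r)"
    using exp_ge_add_one_self[of "\<eta> * y / real r"] by linarith
  then have "(\<eta> * y / real r) ^ r \<le> exp (\<eta> * y / real r) ^ r"
    using assms by (intro power_mono) auto
  also have "\<dots> = exp (\<eta> * y)"
    using assms by (simp flip: exp_of_nat_mult)
  finally have "(real r / \<eta>) ^ r * (\<eta> * y / real r) ^ r \<le> (real r / \<eta>) ^ r * exp (\<eta> * y)"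
    using assms by (intro mult_left_mono) auto
  then show ?thesis
    using assms by (simp flip: power_mult_distrib)
qed

section \<open>Exponential moments and distribution functions of the geometric and negative binomial
  laws\<close>

lemma integrable_exp_geometric1:
  assumes "0 < q" "q < 1" "\<theta> < phi q"
  shows "integrable (geometric1_pmf q) (\<lambda>k. exp (\<theta> * real k))"
proof -
  \<comment> \<open>This is the ratio of the geometric series for the exponential moment;
    \<open>\<theta> < phi q\<close> says exactly that it is below 1.\<close>
  have "exp \<theta> * (1 - q) = exp (\<theta> - phi q)"
    using assms by (simp add: exp_diff exp_minus_phi[symmetric] exp_minus field_simps)
  also have "\<dots> < 1"
    using assms by simp
  finally have *: "norm (exp \<theta> * (1 - q)) < 1"
    using assms by simp
  \<comment> \<open>The constant factor \<open>exp \<theta>\<close> comes from counting trials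
    rather than failures, that is, from \<open>Suc\<close>.\<close>
  have "summable (\<lambda>k. q * exp \<theta> * (exp \<theta> * (1 - q)) ^ k)"
    by (intro summable_mult summable_geometric *)
  also have "(\<lambda>k. q * exp \<theta> * (exp \<theta> * (1 - q)) ^ k) =
      (\<lambda>k. (1 - q) ^ k * q * exp (\<theta> * real (Suc k)))"
    by (simp add: power_mult_distrib exp_add exp_of_nat2_mult distrib_left mult_ac)
  finally show ?thesis
    using assms unfolding geometric1_pmf_def integrable_map_pmf_eq
    unfolding measure_pmf_eq_density
    by (subst integrable_density) (auto simp: integrable_count_space_nat_iff)
qed

text \<open>The exponential of the sum factorizes over the independent coordinates. The range of
  admissible \<open>\<theta>\<close> is therefore the same for every \<open>c\<close>, which is why
  \<open>c\<close> is absent from the asymptotics.\<close>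

lemma integrable_exp_NegBin:
  assumes "0 < q" "q < 1" "\<theta> < phi q"
  shows "integrable (NegBin c q) (\<lambda>k. exp (\<theta> * real k))"
proof -
  have "integrable (Pi_pmf {..<c} 0 (\<lambda>_. geometric1_pmf q)) (\<lambda>x. \<Prod>i<c. exp (\<theta> * real (x i)))"
    using assms by (intro integrable_prod_Pi_pmf integrable_exp_geometric1) auto
  then show ?thesis
    by (simp add: NegBin_def sum_distrib_left exp_sum)
qed

lemma prob_geometric1_le:
  assumes "0 < q" "q < 1"
  shows "measure (geometric1_pmf q) {..k} = 1 - (1 - q) ^ k"
proof -
  \<comment> \<open>At most \<open>k\<close> trials means fewer than \<open>k\<close>
    failures.\<close>
  have "Suc -` {..k} = {..<k}"
    by auto
  then have "measure (geometric1_pmf q) {..k} = (\<Sum>i<k. (1 - q) ^ i * q)"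
    using assms by (simp add: geometric1_pmf_def measure_measure_pmf_finite)
  also have "\<dots> = 1 - (1 - q) ^ k"
    using assms by (simp add: geometric_sum flip: sum_distrib_right)
  finally show ?thesis .
qed

text \<open>The sum dominates its coordinate 0, which exists because \<open>c \<ge> 1\<close> and is
  geometric.\<close>

lemma prob_NegBin_le:
  assumes "0 < q" "q < 1" "c \<ge> 1"
  shows "measure (NegBin c q) {..k} \<le> 1 - (1 - q) ^ k"
proof -
  let ?P = "Pi_pmf {..<c} 0 (\<lambda>_. geometric1_pmf q)"
  have "measure (NegBin c q) {..k} = measure ?P {x. (\<Sum>i<c. x i) \<le> k}"
    by (simp add: NegBin_def vimage_def)
  also have "\<dots> \<le> measure ?P {x. x 0 \<le> k}"
  proof (intro measure_pmf.finite_measure_mono subsetI)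
    fix x :: "nat \<Rightarrow> nat"
    assume "x \<in> {x. (\<Sum>i<c. x i) \<le> k}"
    moreover have "x 0 \<le> (\<Sum>i<c. x i)"
      using assms by (intro member_le_sum) auto
    ultimately show "x \<in> {x. x 0 \<le> k}"
      by simp
  qed simp
  also have "\<dots> = measure (map_pmf (\<lambda>x. x 0) ?P) {..k}"
    by (simp add: vimage_def)
  also have "map_pmf (\<lambda>x. x 0) ?P = geometric1_pmf q"
    using assms by (subst Pi_pmf_component) auto
  finally show ?thesis
    using prob_geometric1_le assms by simp
qed

section \<open>Moments of the maximum of an i.i.d. sample from a general law
  \<open>p\<close>\<close>

context
  fixes M :: "'a measure" and n :: nat and X :: "nat \<Rightarrow> 'a \<Rightarrow> nat" and p :: "nat pmf"
  assumes iid: "iid_sample M n X p" and n: "n \<ge> 1"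
begin

interpretation prob_space M
  using iid by (simp add: iid_sample_def)

lemma iid_distr: "i < n \<Longrightarrow> distr M (count_space UNIV) (X i) = measure_pmf p"
  using iid by (simp add: iid_sample_def)

lemma iid_indep: "indep_vars (\<lambda>_. count_space UNIV) X {..<n}"
  using iid by (simp add: iid_sample_def)

lemma iid_measurable [measurable]: "i < n \<Longrightarrow> X i \<in> measurable M (count_space UNIV)"
  using iid_indep by (simp add: indep_vars_def)

lemma indices_nonempty: "{..<n} \<noteq> {}"
  using n by (auto simp: lessThan_empty_iff)

lemma sample_max_le_iff: "sample_max n X \<omega> \<le> k \<longleftrightarrow> (\<forall>i<n. X i \<omega> \<le> k)"
  using indices_nonempty by (subst sample_max_def, subst Max_le_iff) auto

lemma sample_max_attained: "\<exists>i<n. sample_max n X \<omega> = X i \<omega>"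
proof -
  have "sample_max n X \<omega> \<in> (\<lambda>i. X i \<omega>) ` {..<n}"
    unfolding sample_max_def using indices_nonempty by (intro Max_in) auto
  then show ?thesis
    by auto
qed

lemma sample_max_measurable [measurable]: "sample_max n X \<in> measurable M (count_space UNIV)"
  \<comment> \<open>The image becomes a set comprehension, the form that
    \<open>measurable_Max_nat\<close> expects.\<close>
  unfolding sample_max_def image_def
  by (rule measurable_Max_nat) measurable

lemma prob_sample_max_le: "\<P>(\<omega> in M. sample_max n X \<omega> \<le> k) = measure p {..k} ^ n"
proof -
  have "prob (\<Inter>i\<in>{..<n}. X i -` {..k} \<inter> space M) = (\<Prod>i<n. prob (X i -` {..k} \<inter> space M))"
    using indices_nonempty by (intro indep_varsD[OF iid_indep]) auto
  also have "\<dots> = (\<Prod>i<n. measure p {..k})"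
    by (intro prod.cong refl) (simp add: measure_distr flip: iid_distr)
  also have "(\<Inter>i\<in>{..<n}. X i -` {..k} \<inter> space M) = {\<omega> \<in> space M. sample_max n X \<omega> \<le> k}"
    using indices_nonempty by (auto simp: sample_max_le_iff)
  finally show ?thesis
    by simp
qed

text \<open>The maximum is attained at some index, so its exponential is one of the \<open>n\<close>
  positive terms \<open>exp (\<theta> * X i)\<close> and is at most their sum.\<close>

lemma expectation_sample_max_bound:
  assumes p: "integrable p (\<lambda>k. exp (\<theta> * real k))" and \<theta>: "0 < \<theta>"
  shows "integrable M (\<lambda>\<omega>. exp (\<theta> * real (sample_max n X \<omega>)))"
    and "expectation (\<lambda>\<omega>. exp (\<theta> * real (sample_max n X \<omega>)))
           \<le> real n * measure_pmf.expectation p (\<lambda>k. exp (\<theta> * real k))"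
proof -
  have le: "exp (\<theta> * real (sample_max n X \<omega>)) \<le> (\<Sum>i<n. exp (\<theta> * real (X i \<omega>)))" for \<omega>
  proof -
    obtain i where "i < n" "sample_max n X \<omega> = X i \<omega>"
      using sample_max_attained by blast
    then show ?thesis
      using member_le_sum[of i "{..<n}" "\<lambda>i. exp (\<theta> * real (X i \<omega>))"] by simp
  qed
  have int: "integrable M (\<lambda>\<omega>. exp (\<theta> * real (X i \<omega>)))" if "i < n" for i
  proof (rule integrable_distr[where T = "X i" and M' = "count_space UNIV"])
    show "integrable (distr M (count_space UNIV) (X i)) (\<lambda>k. exp (\<theta> * real k))"
      using p that by (simp add: iid_distr)
  qed (use that in measurable)
  have ex: "expectation (\<lambda>\<omega>. exp (\<theta> * real (X i \<omega>))) =
      measure_pmf.expectation p (\<lambda>k. exp (\<theta> * real k))" if "i < n" for i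
    using that by (simp add: integral_distr flip: iid_distr)
  show int_max: "integrable M (\<lambda>\<omega>. exp (\<theta> * real (sample_max n X \<omega>)))"
  proof (rule Bochner_Integration.integrable_bound)
    show "integrable M (\<lambda>\<omega>. \<Sum>i<n. exp (\<theta> * real (X i \<omega>)))"
      by (intro Bochner_Integration.integrable_sum int) simp
    show "AE \<omega> in M. norm (exp (\<theta> * real (sample_max n X \<omega>))) \<le>
        norm (\<Sum>i<n. exp (\<theta> * real (X i \<omega>)))"
      by (intro AE_I2) (use le in \<open>simp add: sum_nonneg\<close>)
  qed simp
  have "expectation (\<lambda>\<omega>. exp (\<theta> * real (sample_max n X \<omega>))) \<le>
      expectation (\<lambda>\<omega>. \<Sum>i<n. exp (\<theta> * real (X i \<omega>)))"
    by (intro integral_mono int_max Bochner_Integration.integrable_sum int le) simp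
  also have "\<dots> = real n * measure_pmf.expectation p (\<lambda>k. exp (\<theta> * real k))"
    using int ex by (subst Bochner_Integration.integral_sum) auto
  finally show "expectation (\<lambda>\<omega>. exp (\<theta> * real (sample_max n X \<omega>)))
      \<le> real n * measure_pmf.expectation p (\<lambda>k. exp (\<theta> * real k))" .
qed

text \<open>Follows from \<open>power_le_exp\<close> by domination. Integrability has to be known
  before moments are compared, since the integral of a non-integrable function is 0 by
  default.\<close>

lemma integrable_sample_max_power:
  assumes p: "integrable p (\<lambda>k. exp (\<theta> * real k))" and \<theta>: "0 < \<theta>" and r: "r \<ge> 1"
  shows "integrable M (\<lambda>\<omega>. real (sample_max n X \<omega>) ^ r)"
proof (rule Bochner_Integration.integrable_bound)
  show "integrable M (\<lambda>\<omega>. (real r / \<theta>) ^ r * exp (\<theta> * real (sample_max n X \<omega>)))"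
    by (intro integrable_mult_right expectation_sample_max_bound p \<theta>)
  show "AE \<omega> in M. norm (real (sample_max n X \<omega>) ^ r) \<le>
      norm ((real r / \<theta>) ^ r * exp (\<theta> * real (sample_max n X \<omega>)))"
    using power_le_exp[of "real (sample_max n X _)" \<theta> r] \<theta> r by (intro AE_I2) (simp add: abs_mult)
qed simp

text \<open>The factor \<open>n\<close> of the union bound is cancelled by the weight
  \<open>C / n\<close> in the pointwise estimate, so the error term does not depend on
  \<open>n\<close>.\<close>

lemma sample_max_moment_upper:
  assumes p: "integrable p (\<lambda>k. exp (\<theta> * real k))" and \<beta>: "0 < \<beta>" "\<beta> < \<theta>" and r: "r \<ge> 1"
  shows "expectation (\<lambda>\<omega>. real (sample_max n X \<omega>) ^ r) \<le>
    (ln (real n) / \<beta>) ^ r + (real r / (\<theta> - \<beta>)) ^ r * measure_pmf.expectation p (\<lambda>k. exp (\<theta> * real k))"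
proof -
  define C where "C = (real r / (\<theta> - \<beta>)) ^ r"
  have C: "0 \<le> C"
    using \<beta> by (simp add: C_def)
  have T: "0 \<le> ln (real n) / \<beta>"
    using n \<beta> by simp
  have \<theta>: "0 < \<theta>"
    using \<beta> by linarith
  note exp_max = expectation_sample_max_bound[OF p \<theta>]
  have pointwise: "y ^ r \<le> (ln (real n) / \<beta>) ^ r + C / n * exp (\<theta> * y)" if "0 \<le> y" for y :: real
  proof (cases "y \<le> ln (real n) / \<beta>")
    case True
    then have "y ^ r \<le> (ln (real n) / \<beta>) ^ r"
      using that by (intro power_mono)
    then show ?thesis
      using C by (simp add: add_increasing2)
  next
    case False
    then have "ln (real n) \<le> \<beta> * y"
      using \<beta> by (simp add: field_simps)
    \<comment> \<open>The margin \<open>\<theta> - \<beta>\<close> absorbs the power; beyond the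
      threshold, the factor \<open>exp (- \<beta> * y)\<close> left over is at most
      \<open>1 / n\<close>.\<close>
    have "y ^ r \<le> C * exp ((\<theta> - \<beta>) * y)"
      unfolding C_def using that \<beta> r by (intro power_le_exp) auto
    also have "(\<theta> - \<beta>) * y \<le> \<theta> * y - ln (real n)"
      using \<open>ln (real n) \<le> \<beta> * y\<close> by (simp add: algebra_simps)
    then have "C * exp ((\<theta> - \<beta>) * y) \<le> C * exp (\<theta> * y - ln (real n))"
      using C by (intro mult_left_mono) auto
    also have "\<dots> = C / n * exp (\<theta> * y)"
      using n by (simp add: exp_diff)
    finally show ?thesis
      using T by (simp add: add_increasing)
  qed
  have "expectation (\<lambda>\<omega>. real (sample_max n X \<omega>) ^ r) \<le>
      expectation (\<lambda>\<omega>. (ln (real n) / \<beta>) ^ r + C / n * exp (\<theta> * real (sample_max n X \<omega>)))"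
    using exp_max(1)
    by (intro integral_mono integrable_sample_max_power[OF p \<theta> r] pointwise) auto
  also have "\<dots> = (ln (real n) / \<beta>) ^ r + C / n * expectation (\<lambda>\<omega>. exp (\<theta> * real (sample_max n X \<omega>)))"
    using exp_max(1) by (simp add: prob_space)
  also have "\<dots> \<le> (ln (real n) / \<beta>) ^ r +
      C / n * (real n * measure_pmf.expectation p (\<lambda>k. exp (\<theta> * real k)))"
    using exp_max(2) C by (intro add_left_mono mult_left_mono) auto
  finally show ?thesis
    using n by (simp add: C_def)
qed

text \<open>Markov's inequality: the power is at least \<open>t ^ r\<close> where the maximum
  exceeds \<open>t\<close>. For an integer-valued maximum this is the same as exceeding the integer
  part of \<open>t\<close>, and independence gives the probability.\<close>

lemma sample_max_moment_lower:
  assumes int: "integrable M (\<lambda>\<omega>. real (sample_max n X \<omega>) ^ r)" and t: "0 \<le> t"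
  shows "t ^ r * (1 - measure p {..nat \<lfloor>t\<rfloor>} ^ n) \<le> expectation (\<lambda>\<omega>. real (sample_max n X \<omega>) ^ r)"
proof -
  define A where "A = {\<omega> \<in> space M. \<not> sample_max n X \<omega> \<le> nat \<lfloor>t\<rfloor>}"
  have A: "A \<in> events"
    unfolding A_def by measurable
  have "prob A = 1 - measure p {..nat \<lfloor>t\<rfloor>} ^ n"
    unfolding A_def by (subst prob_neg) (simp_all add: prob_sample_max_le)
  then have "t ^ r * (1 - measure p {..nat \<lfloor>t\<rfloor>} ^ n) = expectation (\<lambda>\<omega>. t ^ r * indicator A \<omega>)"
    using A by simp
  also have "\<dots> \<le> expectation (\<lambda>\<omega>. real (sample_max n X \<omega>) ^ r)"
  proof (intro integral_mono int)
    show "integrable M (\<lambda>\<omega>. t ^ r * indicator A \<omega>)"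
      using A by (simp add: emeasure_eq_measure)
    show "t ^ r * indicator A \<omega> \<le> real (sample_max n X \<omega>) ^ r" for \<omega>
    proof (cases "\<omega> \<in> A")
      case True
      then have "t \<le> real (sample_max n X \<omega>)"
        using t unfolding A_def by simp linarith
      then show ?thesis
        using t True by (simp add: power_mono)
    qed simp
  qed
  finally show ?thesis .
qed

end

section \<open>Asymptotics of the moments in the negative binomial case\<close>

theorem proposition23:
  fixes q :: real and c r :: nat
    and M :: "nat \<Rightarrow> 'a measure" and X :: "nat \<Rightarrow> nat \<Rightarrow> 'a \<Rightarrow> nat"
  assumes "0 < q" "q < 1" "c \<ge> 1" "r \<ge> 1"
    and "\<And>n. n \<ge> 1 \<Longrightarrow> iid_sample (M n) n (X n) (NegBin c q)"
  shows "(\<lambda>n. \<integral>\<omega>. real (sample_max n (X n) \<omega>) ^ r \<partial>M n)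
           \<sim>[at_top] (\<lambda>n. (1 / phi q * ln (real n)) ^ r)"
proof -
  define E where "E n = (\<integral>\<omega>. real (sample_max n (X n) \<omega>) ^ r \<partial>M n)" for n
  define L where "L n = 1 / phi q * ln (real n)" for n
  note iid = assms(5)
  have \<phi>: "0 < phi q"
    using assms by (intro phi_pos)
  have L_pos: "0 < L n" if "n \<ge> 2" for n
    using that \<phi> by (simp add: L_def)
  have int: "integrable (NegBin c q) (\<lambda>k. exp (\<theta> * real k))" if "\<theta> < phi q" for \<theta>
    using assms that by (intro integrable_exp_NegBin)
  have int_max: "integrable (M n) (\<lambda>\<omega>. real (sample_max n (X n) \<omega>) ^ r)" if "n \<ge> 1" for n
    \<comment> \<open>Any exponent strictly between 0 and \<open>phi q\<close> would do.\<close>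
    using integrable_sample_max_power[OF iid[OF that] that int, of "phi q / 2"] \<phi> assms(4) by simp

  have lower: "\<alpha> ^ r * (1 - exp (- (real n powr (1 - \<alpha>)))) \<le> E n / L n ^ r"
    if \<alpha>: "0 \<le> \<alpha>" and n: "n \<ge> 2" for \<alpha> and n :: nat
  proof -
    \<comment> \<open>Rounding down can only increase \<open>(1 - q) ^ k\<close>, so the tail bound
      \<open>n powr (- \<alpha>)\<close> survives it.\<close>
    define k where "k = nat \<lfloor>\<alpha> * L n\<rfloor>"
    have t: "0 \<le> \<alpha> * L n"
      using \<alpha> L_pos[OF n] by simp
    have "real k \<le> \<alpha> * L n"
      using t by (simp add: k_def)
    then have "phi q * real k \<le> \<alpha> * ln (real n)"
      using \<phi> by (simp add: L_def field_simps)
    then have "exp (- \<alpha> * ln (real n)) \<le> exp (real k * (- phi q))"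
      by (simp add: algebra_simps)
    also have "\<dots> = (1 - q) ^ k"
      using assms by (simp only: exp_of_nat_mult exp_minus_phi)
    finally have tail: "real n powr (- \<alpha>) \<le> (1 - q) ^ k"
      using n by (simp add: powr_def)
    have "measure (NegBin c q) {..k} \<le> 1 - real n powr (- \<alpha>)"
      using prob_NegBin_le[of q c k] tail assms by linarith
    \<comment> \<open>With \<open>1 - x \<le> exp (- x)\<close>, the \<open>n\<close>-th power turns
      into a factor \<open>n\<close> in the exponent.\<close>
    also have "\<dots> \<le> exp (- (real n powr (- \<alpha>)))"
      using exp_ge_add_one_self[of "- (real n powr (- \<alpha>))"] by simp
    finally have "measure (NegBin c q) {..k} ^ n \<le> exp (- (real n powr (- \<alpha>))) ^ n"
      by (intro power_mono) auto
    also have "\<dots> = exp (- (n * real n powr (- \<alpha>)))"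
      by (simp flip: exp_of_nat_mult)
    also have "n * real n powr (- \<alpha>) = real n powr (1 - \<alpha>)"
      using n by (simp add: powr_diff powr_minus field_simps)
    finally have "(\<alpha> * L n) ^ r * (1 - exp (- (real n powr (1 - \<alpha>)))) \<le>
        (\<alpha> * L n) ^ r * (1 - measure (NegBin c q) {..k} ^ n)"
      using t by (intro mult_left_mono) auto
    also have "\<dots> \<le> E n"
      unfolding E_def k_def using n t by (intro sample_max_moment_lower iid int_max) auto
    finally show ?thesis
      using L_pos[OF n] by (simp add: field_simps)
  qed

  \<comment> \<open>\<open>K\<close> may depend on \<open>\<beta>\<close> but not on
    \<open>n\<close>, so \<open>K / L n ^ r\<close> vanishes in the limit.\<close>
  have upper: "\<exists>K. \<forall>n\<ge>2. E n / L n ^ r \<le> (phi q / \<beta>) ^ r + K / L n ^ r"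
    if \<beta>: "0 < \<beta>" "\<beta> < phi q" for \<beta>
  proof -
    obtain \<theta> where \<theta>: "\<beta> < \<theta>" "\<theta> < phi q"
      using dense \<beta> by blast
    define K where "K = (real r / (\<theta> - \<beta>)) ^ r *
      measure_pmf.expectation (NegBin c q) (\<lambda>k. exp (\<theta> * real k))"
    have "E n / L n ^ r \<le> (phi q / \<beta>) ^ r + K / L n ^ r" if n: "n \<ge> 2" for n
    proof -
      have "E n \<le> (ln (real n) / \<beta>) ^ r + K"
        unfolding E_def K_def using n \<theta> \<beta> assms(4)
        by (intro sample_max_moment_upper iid int) auto
      also have "ln (real n) / \<beta> = phi q / \<beta> * L n"
        using \<phi> by (simp add: L_def)
      finally have "E n \<le> (phi q / \<beta> * L n) ^ r + K" .
      then show ?thesis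
        using L_pos[OF n] by (simp add: power_mult_distrib field_simps)
    qed
    then show ?thesis
      by blast
  qed

  have "(\<lambda>n. E n / L n ^ r) \<longlonglongrightarrow> 1"
  proof (rule order_tendstoI)
    fix a :: real
    assume a: "a < 1"
    \<comment> \<open>First \<open>\<alpha> < 1\<close> is fixed with \<open>\<alpha> ^ r\<close>
      still above \<open>a\<close>; only then does \<open>n\<close> grow.\<close>
    have "((\<lambda>\<alpha>. \<alpha> ^ r) \<longlongrightarrow> (1::real) ^ r) (at_left 1)"
      by (intro tendsto_intros)
    then have "eventually (\<lambda>\<alpha>. a < \<alpha> ^ r) (at_left (1::real))"
      using a by (intro order_tendstoD) simp
    moreover have "eventually (\<lambda>\<alpha>. \<alpha> \<in> {0<..<1}) (at_left (1::real))"
      by (rule eventually_at_left_real) simp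
    ultimately have "eventually (\<lambda>\<alpha>. a < \<alpha> ^ r \<and> \<alpha> \<in> {0<..<1}) (at_left (1::real))"
      by (rule eventually_conj)
    then obtain \<alpha> where \<alpha>: "a < \<alpha> ^ r" "0 < \<alpha>" "\<alpha> < 1"
      using eventually_happens'[OF trivial_limit_at_left_real] by auto
    have "(\<lambda>n. \<alpha> ^ r * (1 - exp (- (real n powr (1 - \<alpha>))))) \<longlonglongrightarrow> \<alpha> ^ r * (1 - 0)"
      using \<alpha> by real_asymp
    then have "eventually (\<lambda>n. a < \<alpha> ^ r * (1 - exp (- (real n powr (1 - \<alpha>))))) sequentially"
      using \<alpha> by (intro order_tendstoD) simp
    then show "eventually (\<lambda>n. a < E n / L n ^ r) sequentially"
      using eventually_ge_at_top[of 2]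
      by eventually_elim (use lower \<alpha> in \<open>force intro: less_le_trans\<close>)
  next
    fix a :: real
    assume a: "1 < a"
    \<comment> \<open>Likewise \<open>\<beta>\<close> is fixed just below \<open>phi q\<close>,
      where the leading constant is still below \<open>a\<close>.\<close>
    have "((\<lambda>\<beta>. (phi q / \<beta>) ^ r) \<longlongrightarrow> (phi q / phi q) ^ r) (at_left (phi q))"
      using \<phi> by (intro tendsto_intros) simp
    then have "eventually (\<lambda>\<beta>. (phi q / \<beta>) ^ r < a) (at_left (phi q))"
      using a \<phi> by (intro order_tendstoD) simp_all
    moreover have "eventually (\<lambda>\<beta>. \<beta> \<in> {0<..<phi q}) (at_left (phi q))"
      using \<phi> by (rule eventually_at_left_real)
    ultimately have "eventually (\<lambda>\<beta>. (phi q / \<beta>) ^ r < a \<and> \<beta> \<in> {0<..<phi q}) (at_left (phi q))"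
      by (rule eventually_conj)
    then obtain \<beta> where \<beta>: "(phi q / \<beta>) ^ r < a" "0 < \<beta>" "\<beta> < phi q"
      using eventually_happens'[OF trivial_limit_at_left_real] by auto
    obtain K where K: "\<And>n. n \<ge> 2 \<Longrightarrow> E n / L n ^ r \<le> (phi q / \<beta>) ^ r + K / L n ^ r"
      using upper \<beta> by blast
    have "filterlim L at_top sequentially"
      unfolding L_def using \<phi>
      by (intro filterlim_tendsto_pos_mult_at_top[OF tendsto_const]
          filterlim_compose[OF ln_at_top filterlim_real_sequentially]) simp
    \<comment> \<open>\<open>r \<ge> 1\<close> makes the normalization diverge, which removes the
      bounded error \<open>K\<close>.\<close>
    then have "filterlim (\<lambda>n. L n ^ r) at_top sequentially"
      using assms(4) by (intro filterlim_pow_at_top) auto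
    then have "(\<lambda>n. (phi q / \<beta>) ^ r + K / L n ^ r) \<longlonglongrightarrow> (phi q / \<beta>) ^ r + 0"
      by (intro tendsto_intros real_tendsto_divide_at_top[OF tendsto_const])
    then have "eventually (\<lambda>n. (phi q / \<beta>) ^ r + K / L n ^ r < a) sequentially"
      using \<beta> by (intro order_tendstoD) simp
    then show "eventually (\<lambda>n. E n / L n ^ r < a) sequentially"
      using eventually_ge_at_top[of 2]
      by eventually_elim (use K in \<open>force intro: le_less_trans\<close>)
  qed
  then have "E \<sim>[at_top] (\<lambda>n. L n ^ r)"
    by (intro asymp_equivI')
  then show ?thesis
    by (simp only: E_def[abs_def] L_def[abs_def])
qed

end
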